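(* Let $L_1,L_2,\lambda,\eta,H_0>0$ and $k=2\pi/\lambda$. Let $(\mathbf n,\mathbf l_1,\mathbf l_2)$ be mutually orthonormal vectors in $\mathbb R^3$, let $\mathbf a_t,\mathbf a_E,\mathbf a_H\in\mathbb R^3$ be mutually orthogonal unit vectors with $\mathbf a_t=\mathbf a_E\times\mathbf a_H$, and let $\mathbf a_r\in\mathbb R^3$ be a unit vector. Consider the $L_1\times L_2$ rectangular metal plate centered at the origin with edge directions $\mathbf l_1,\mathbf l_2$ and normal $\mathbf n$, illuminated by a uniform plane wave with incident direction $\mathbf a_t$ and magnetic field direction $\mathbf a_H$, in the physical-optics far-field model described in the context. Then the radar cross section of the plate when observed at direction $\mathbf a_r$ is $$\sigma=\sigma_{\max}\, f_{J_s}\, f_{AF},\qquad \sigma_{\max}=\frac{4\pi L_1^2L_2^2}{\lambda^2},\qquad f_{J_s}=\big\|(\mathbf n\times\mathbf a_H)\times\mathbf a_r\big\|^2\le 1,$$ $$f_{AF}=\mathrm{sinc}^2\!\Big(\tfrac{kL_1}{2}(\mathbf a_r-\mathbf a_t)\cdot\mathbf l_1\Big)\,\mathrm{sinc}^2\!\Big(\tfrac{kL_2}{2}(\mathbf a_r-\mathbf a_t)\cdot\mathbf l_2\Big)\le 1 .$$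
   Context: Convention: $\mathrm{sinc}(x)=\sin(x)/x$ for $x\neq0$, $\mathrm{sinc}(0)=1$. $\times$ is the cross product, $\cdot$ the inner product, $j^2=-1$. Plate: $S=\{\alpha\mathbf l_1+\beta\mathbf l_2:\ |\alpha|\le L_1/2,\ |\beta|\le L_2/2\}$, treated as a perfect electric conductor. Incident wave: at position $\mathbf r\in\mathbb R^3$, $\mathbf E^t(\mathbf r)=\eta H_0e^{-jk\mathbf a_t\cdot\mathbf r}\mathbf a_E$ and $\mathbf H^t(\mathbf r)=H_0e^{-jk\mathbf a_t\cdot\mathbf r}\mathbf a_H$; here $\lambda$ is the wavelength, $k$ the wave number, $\eta$ the characteristic impedance, $H_0$ the magnitude of the incident magnetic field. Induced current (physical optics): for $\mathbf r'\in S$, $\mathbf J_s(\mathbf r')=2\,\mathbf n\times\mathbf H^t(\mathbf r')=2H_0(\mathbf n\times\mathbf a_H)e^{-jk\mathbf a_t\cdot\mathbf r'}$. Reflected far field at the point $d_r\mathbf a_r$, at distance $d_r>0$ from the origin: its spherical components are taken to be $E^r_\rho=0$ and $$E^r_\theta=-\frac{jk\eta e^{-jkd_r}}{4\pi d_r}\iint_S\mathbf J_s(\mathbf r')\cdot\mathbf a_{r\theta}\,e^{jk\mathbf r'\cdot\mathbf a_r}\,ds,\qquad E^r_\phi=-\frac{jk\eta e^{-jkd_r}}{4\pi d_r}\iint_S\mathbf J_s(\mathbf r')\cdot\mathbf a_{r\phi}\,e^{jk\mathbf r'\cdot\mathbf a_r}\,ds,$$ where $\mathbf a_{r\theta},\mathbf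 a_{r\phi}$ are the spherical unit vectors at direction $\mathbf a_r$: if $\mathbf a_r=(\sin\theta_r\cos\phi_r,\sin\theta_r\sin\phi_r,\cos\theta_r)$ then $\mathbf a_{r\theta}=(\cos\theta_r\cos\phi_r,\cos\theta_r\sin\phi_r,-\sin\theta_r)$ and $\mathbf a_{r\phi}=(-\sin\phi_r,\cos\phi_r,0)$, so that $(\mathbf a_r,\mathbf a_{r\theta},\mathbf a_{r\phi})$ is an orthonormal basis. Radar cross section: $\sigma=\lim_{d_r\to\infty}4\pi d_r^2\,\dfrac{|\mathbf E^r|^2}{|\mathbf E^t|^2}$, where $|\mathbf E^r|^2=|E^r_\theta|^2+|E^r_\phi|^2$ and $|\mathbf E^t|^2=\eta^2H_0^2$. *)

theory Defs
  imports "HOL-Analysis.Analysis" "HOL-Probability.Sinc_Integral"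
begin

definition orthonormal3 :: "real^3 \<Rightarrow> real^3 \<Rightarrow> real^3 \<Rightarrow> bool" where
  "orthonormal3 u v w \<longleftrightarrow>
     norm u = 1 \<and> norm v = 1 \<and> norm w = 1 \<and>
     orthogonal u v \<and> orthogonal u w \<and> orthogonal v w"

text \<open>Phasor fields take values in \<open>complex^3\<close>.  The cross product and the dot product
  are extended bilinearly, so \<open>cdot\<close> does not conjugate either argument.\<close>

definition cvec :: "real^3 \<Rightarrow> complex^3" where
  "cvec v = (\<chi> i. complex_of_real (v $ i))"

definition ccross :: "complex^3 \<Rightarrow> complex^3 \<Rightarrow> complex^3" where
  "ccross a b = vector [a$2 * b$3 - a$3 * b$2,
                        a$3 * b$1 - a$1 * b$3,
                        a$1 * b$2 - a$2 * b$1]"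

definition cdot :: "complex^3 \<Rightarrow> complex^3 \<Rightarrow> complex" where
  "cdot a b = (\<Sum>i\<in>UNIV. a $ i * b $ i)"

definition sph_r :: "real \<Rightarrow> real \<Rightarrow> real^3" where
  "sph_r \<theta> \<phi> = vector [sin \<theta> * cos \<phi>, sin \<theta> * sin \<phi>, cos \<theta>]"

definition sph_theta :: "real \<Rightarrow> real \<Rightarrow> real^3" where
  "sph_theta \<theta> \<phi> = vector [cos \<theta> * cos \<phi>, cos \<theta> * sin \<phi>, - sin \<theta>]"

definition sph_phi :: "real \<Rightarrow> real \<Rightarrow> real^3" where
  "sph_phi \<theta> \<phi> = vector [- sin \<phi>, cos \<phi>, 0]"

text \<open>The integral of \<open>f\<close> with respect to surface area over the surface parametrised by
  \<open>p\<close> on the parameter domain \<open>D\<close>, with area element \<open>\<bar>p\<^sub>u \<times> p\<^sub>v\<bar> du dv\<close>.\<close>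

definition surface_integral ::
    "(real \<times> real \<Rightarrow> real^3) \<Rightarrow> (real \<times> real) set \<Rightarrow> (real^3 \<Rightarrow> complex) \<Rightarrow> complex" where
  "surface_integral p D f =
     integral D (\<lambda>(u, v).
       norm (cross3 (vector_derivative (\<lambda>s. p (s, v)) (at u))
                    (vector_derivative (\<lambda>t. p (u, t)) (at v))) *\<^sub>R f (p (u, v)))"

definition plate_param :: "real^3 \<Rightarrow> real^3 \<Rightarrow> real \<times> real \<Rightarrow> real^3" where
  "plate_param l1 l2 = (\<lambda>(\<alpha>, \<beta>). \<alpha> *\<^sub>R l1 + \<beta> *\<^sub>R l2)"

definition plate_domain :: "real \<Rightarrow> real \<Rightarrow> (real \<times> real) set" where
  "plate_domain L1 L2 = {- L1 / 2 .. L1 / 2} \<times> {- L2 / 2 .. L2 / 2}"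

definition plate :: "real \<Rightarrow> real \<Rightarrow> real^3 \<Rightarrow> real^3 \<Rightarrow> (real^3) set" where
  "plate L1 L2 l1 l2 = {\<alpha> *\<^sub>R l1 + \<beta> *\<^sub>R l2 |\<alpha> \<beta>. \<bar>\<alpha>\<bar> \<le> L1 / 2 \<and> \<bar>\<beta>\<bar> \<le> L2 / 2}"

definition incident_E ::
    "real \<Rightarrow> real \<Rightarrow> real \<Rightarrow> real^3 \<Rightarrow> real^3 \<Rightarrow> real^3 \<Rightarrow> complex^3" where
  "incident_E k \<eta> H0 a_t a_E r =
     (complex_of_real (\<eta> * H0) * exp (- \<i> * complex_of_real (k * (a_t \<bullet> r)))) *s cvec a_E"

definition incident_H :: "real \<Rightarrow> real \<Rightarrow> real^3 \<Rightarrow> real^3 \<Rightarrow> real^3 \<Rightarrow> complex^3" where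
  "incident_H k H0 a_t a_H r =
     (complex_of_real H0 * exp (- \<i> * complex_of_real (k * (a_t \<bullet> r)))) *s cvec a_H"

definition induced_current ::
    "real \<Rightarrow> real \<Rightarrow> real^3 \<Rightarrow> real^3 \<Rightarrow> real^3 \<Rightarrow> real^3 \<Rightarrow> complex^3" where
  "induced_current k H0 n a_t a_H r = 2 *s ccross (cvec n) (incident_H k H0 a_t a_H r)"

text \<open>The component along \<open>b\<close> of the reflected far field at the point \<open>d *\<^sub>R a_r\<close>.\<close>

definition far_field_component ::
    "real \<Rightarrow> real \<Rightarrow> real \<Rightarrow> real \<Rightarrow> real \<Rightarrow> real^3 \<Rightarrow> real^3 \<Rightarrow> real^3 \<Rightarrow> real^3 \<Rightarrow> real^3
      \<Rightarrow> real^3 \<Rightarrow> real^3 \<Rightarrow> real \<Rightarrow> complex" where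
  "far_field_component k \<eta> H0 L1 L2 n l1 l2 a_t a_H a_r b d =
     - (\<i> * complex_of_real (k * \<eta>) * exp (- \<i> * complex_of_real (k * d))
          / complex_of_real (4 * pi * d)) *
     surface_integral (plate_param l1 l2) (plate_domain L1 L2)
       (\<lambda>r'. cdot (induced_current k H0 n a_t a_H r') (cvec b)
             * exp (\<i> * complex_of_real (k * (r' \<bullet> a_r))))"

text \<open>The radial component of the reflected far field is zero.\<close>

definition reflected_sq ::
    "real \<Rightarrow> real \<Rightarrow> real \<Rightarrow> real \<Rightarrow> real \<Rightarrow> real^3 \<Rightarrow> real^3 \<Rightarrow> real^3 \<Rightarrow> real^3 \<Rightarrow> real^3
      \<Rightarrow> real \<Rightarrow> real \<Rightarrow> real \<Rightarrow> real" where
  "reflected_sq k \<eta> H0 L1 L2 n l1 l2 a_t a_H \<theta> \<phi> d =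
     (cmod (far_field_component k \<eta> H0 L1 L2 n l1 l2 a_t a_H
              (sph_r \<theta> \<phi>) (sph_theta \<theta> \<phi>) d))\<^sup>2 +
     (cmod (far_field_component k \<eta> H0 L1 L2 n l1 l2 a_t a_H
              (sph_r \<theta> \<phi>) (sph_phi \<theta> \<phi>) d))\<^sup>2"

text \<open>The incident amplitude is evaluated at the plate centre; it is the same at every
  point, see \<open>norm_incident_E\<close> below.\<close>

definition scattering_ratio ::
    "real \<Rightarrow> real \<Rightarrow> real \<Rightarrow> real \<Rightarrow> real \<Rightarrow> real^3 \<Rightarrow> real^3 \<Rightarrow> real^3
      \<Rightarrow> real^3 \<Rightarrow> real^3 \<Rightarrow> real^3 \<Rightarrow> real \<Rightarrow> real \<Rightarrow> real \<Rightarrow> real" where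
  "scattering_ratio k \<eta> H0 L1 L2 n l1 l2 a_t a_E a_H \<theta> \<phi> d =
     4 * pi * d\<^sup>2 * (reflected_sq k \<eta> H0 L1 L2 n l1 l2 a_t a_H \<theta> \<phi> d
                    / (norm (incident_E k \<eta> H0 a_t a_E 0))\<^sup>2)"

definition radar_cross_section ::
    "real \<Rightarrow> real \<Rightarrow> real \<Rightarrow> real \<Rightarrow> real \<Rightarrow> real^3 \<Rightarrow> real^3 \<Rightarrow> real^3
      \<Rightarrow> real^3 \<Rightarrow> real^3 \<Rightarrow> real^3 \<Rightarrow> real \<Rightarrow> real \<Rightarrow> real" where
  "radar_cross_section k \<eta> H0 L1 L2 n l1 l2 a_t a_E a_H \<theta> \<phi> =
     Lim at_top (scattering_ratio k \<eta> H0 L1 L2 n l1 l2 a_t a_E a_H \<theta> \<phi>)"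

definition sigma_max :: "real \<Rightarrow> real \<Rightarrow> real \<Rightarrow> real" where
  "sigma_max L1 L2 lam = 4 * pi * L1\<^sup>2 * L2\<^sup>2 / lam\<^sup>2"

definition f_Js :: "real^3 \<Rightarrow> real^3 \<Rightarrow> real^3 \<Rightarrow> real" where
  "f_Js n a_H a_r = (norm (cross3 (cross3 n a_H) a_r))\<^sup>2"

definition f_AF ::
    "real \<Rightarrow> real \<Rightarrow> real \<Rightarrow> real^3 \<Rightarrow> real^3 \<Rightarrow> real^3 \<Rightarrow> real^3 \<Rightarrow> real" where
  "f_AF k L1 L2 l1 l2 a_t a_r =
     (sinc (k * L1 / 2 * ((a_r - a_t) \<bullet> l1)))\<^sup>2 * (sinc (k * L2 / 2 * ((a_r - a_t) \<bullet> l2)))\<^sup>2"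

lemma plate_param_image: "plate_param l1 l2 ` plate_domain L1 L2 = plate L1 L2 l1 l2"
  unfolding plate_param_def plate_domain_def plate_def
  by (force simp: abs_le_iff)

lemma plate_param_inj:
  assumes "orthonormal3 n l1 l2"
  shows "inj (plate_param l1 l2)"
proof (rule injI, clarsimp simp: plate_param_def)
  fix a b a' b' :: real
  assume e: "a *\<^sub>R l1 + b *\<^sub>R l2 = a' *\<^sub>R l1 + b' *\<^sub>R l2"
  have o: "l1 \<bullet> l1 = 1" "l2 \<bullet> l2 = 1" "l1 \<bullet> l2 = 0" "l2 \<bullet> l1 = 0"
    using assms by (auto simp: orthonormal3_def orthogonal_def norm_eq_1 inner_commute)
  show "a = a' \<and> b = b'"
    using arg_cong[OF e, of "\<lambda>x. x \<bullet> l1"] arg_cong[OF e, of "\<lambda>x. x \<bullet> l2"]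
    by (simp add: inner_left_distrib o)
qed

lemma norm_cvec: "norm (cvec v) = norm v"
  by (simp add: cvec_def norm_vec_def)

lemma norm_incident_E:
  assumes "norm a_E = 1"
  shows "(norm (incident_E k \<eta> H0 a_t a_E r))\<^sup>2 = \<eta>\<^sup>2 * H0\<^sup>2"
proof -
  have "norm (c *s v) = cmod c * norm v" for c and v :: "complex^3"
    by (simp add: norm_vec_def norm_mult L2_set_right_distrib)
  then show ?thesis
    using assms
    by (simp add: incident_E_def norm_cvec norm_mult power_mult_distrib)
qed

lemma induced_current_eq:
  "induced_current k H0 n a_t a_H r =
     (complex_of_real (2 * H0) * exp (- \<i> * complex_of_real (k * (a_t \<bullet> r)))) *s cvec (cross3 n a_H)"
  by (simp add: induced_current_def incident_H_def ccross_def cross3_def cvec_def vec_eq_iff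
      forall_3 algebra_simps)

lemma orthonormal3_sph: "orthonormal3 (sph_r \<theta> \<phi>) (sph_theta \<theta> \<phi>) (sph_phi \<theta> \<phi>)"
proof -
  have t: "(sin \<theta>)\<^sup>2 = 1 - (cos \<theta>)\<^sup>2" and p: "(sin \<phi>)\<^sup>2 = 1 - (cos \<phi>)\<^sup>2"
    by (simp_all add: sin_squared_eq)
  have "sph_r \<theta> \<phi> \<bullet> sph_r \<theta> \<phi> = 1"
    unfolding sph_r_def inner_vec_def sum_3 vector_3 inner_real_def using t p by algebra
  moreover have "sph_theta \<theta> \<phi> \<bullet> sph_theta \<theta> \<phi> = 1"
    unfolding sph_theta_def inner_vec_def sum_3 vector_3 inner_real_def using t p by algebra
  moreover have "sph_phi \<theta> \<phi> \<bullet> sph_phi \<theta> \<phi> = 1"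
    unfolding sph_phi_def inner_vec_def sum_3 vector_3 inner_real_def using p by algebra
  moreover have "sph_r \<theta> \<phi> \<bullet> sph_theta \<theta> \<phi> = 0"
    unfolding sph_r_def sph_theta_def inner_vec_def sum_3 vector_3 inner_real_def
    using t p by algebra
  moreover have "sph_r \<theta> \<phi> \<bullet> sph_phi \<theta> \<phi> = 0" "sph_theta \<theta> \<phi> \<bullet> sph_phi \<theta> \<phi> = 0"
    unfolding sph_r_def sph_theta_def sph_phi_def inner_vec_def sum_3 vector_3 inner_real_def
    by algebra+
  ultimately show ?thesis
    by (simp add: orthonormal3_def orthogonal_def norm_eq_1)
qed

lemma unit_vector_sph:
  fixes a :: "real^3"
  assumes "norm a = 1"
  shows "\<exists>\<theta> \<phi>. a = sph_r \<theta> \<phi>"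
proof -
  have n: "(a$1)\<^sup>2 + (a$2)\<^sup>2 + (a$3)\<^sup>2 = 1"
    using assms by (simp add: norm_eq_1 inner_vec_def sum_3 power2_eq_square)
  define s where "s = sqrt ((a$1)\<^sup>2 + (a$2)\<^sup>2)"
  have s2: "s\<^sup>2 = (a$1)\<^sup>2 + (a$2)\<^sup>2"
    by (simp add: s_def)
  then have "(a$3)\<^sup>2 + s\<^sup>2 = 1"
    using n by simp
  then obtain \<theta> where \<theta>: "a$3 = cos \<theta>" "s = sin \<theta>"
    using sincos_total_2pi by metis
  obtain \<phi> where "a$1 = s * cos \<phi>" "a$2 = s * sin \<phi>"
  proof (cases "s = 0")
    case True
    then show ?thesis
      using s2 that by simp
  next
    case False
    then have "(a$1 / s)\<^sup>2 + (a$2 / s)\<^sup>2 = 1"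
      by (simp add: power_divide flip: add_divide_distrib s2)
    then obtain \<phi> where "a$1 / s = cos \<phi>" "a$2 / s = sin \<phi>"
      using sincos_total_2pi by metis
    then show ?thesis
      using False that by (simp add: field_simps)
  qed
  then have "a = sph_r \<theta> \<phi>"
    using \<theta> by (simp add: sph_r_def vec_eq_iff forall_3)
  then show ?thesis
    by blast
qed

end

theory Submission
  imports Defs
begin

text \<open>On the plate the phase of the integrand is linear in both parameters, so the radiation
  integral factors into two one-dimensional Fourier integrals of an interval, each a sinc.
  The polarisation factors of the two spherical components add up to \<open>\<bar>J \<times> a_r\<bar>\<^sup>2\<close>, since
  \<open>a_r\<close> completes them to an orthonormal basis.  The distance cancels, so the scattering ratio is
  constant in \<open>d > 0\<close>.\<close>

lemma abs_sinc_le_one: "\<bar>sinc x\<bar> \<le> 1"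
  by (cases "x = 0") (simp_all add: abs_sin_le_one abs_sin_x_le_abs_x divide_le_eq)

lemma integral_exp_i:
  fixes p L :: real
  assumes "L \<ge> 0"
  shows "integral {- L / 2 .. L / 2} (\<lambda>u. exp (\<i> * complex_of_real (p * u)))
         = complex_of_real (L * sinc (p * L / 2))"
\<comment> \<open>At \<open>p = 0\<close> the antiderivative \<open>F\<close> would divide by zero,
  and at \<open>p = 0\<close> or \<open>L = 0\<close> the argument of \<open>sinc\<close> vanishes;
  there \<open>sinc 0 = 1\<close> makes both sides \<open>L\<close>.\<close>
proof (cases "p = 0 \<or> L = 0")
  case True
  then show ?thesis
    using assms by (auto simp: scaleR_conv_of_real)
next
  case False
  define F where "F u = exp (\<i> * complex_of_real (p * u)) / (\<i> * complex_of_real p)" for u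
  have "(F has_vector_derivative exp (\<i> * complex_of_real (p * u))) (at u within S)" for u S
    unfolding F_def using False
    by (auto intro!: derivative_eq_intros has_vector_derivative_real_field simp: mult_ac)
  then have "((\<lambda>u. exp (\<i> * complex_of_real (p * u))) has_integral (F (L / 2) - F (- L / 2)))
      {- L / 2 .. L / 2}"
    using assms by (intro fundamental_theorem_of_calculus) auto
  \<comment> \<open>The cosines cancel and the sines add, leaving
    \<open>2 * sin (p * L / 2) / p\<close>.\<close>
  moreover have "F (L / 2) - F (- L / 2) = complex_of_real (L * sinc (p * L / 2))"
    using False unfolding F_def cis_conv_exp[symmetric]
    by (simp add: complex_eq_iff Re_divide Im_divide field_simps)
  ultimately show ?thesis
    by (simp add: integral_unique)
qed

lemma norm_cross3_orthonormal:
  assumes "orthonormal3 n l1 l2"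
  shows "norm (cross3 l1 l2) = 1"
  using assms norm_cross[of l1 l2] norm_ge_zero[of "cross3 l1 l2"]
  by (auto simp: orthonormal3_def orthogonal_def power2_eq_1_iff simp del: norm_ge_zero)

text \<open>By Lagrange's identity the gap between the two squares is
  \<open>(x \<bullet> y)\<^sup>2\<close>. Applied twice, this bounds \<open>f_Js\<close>.\<close>

lemma norm_cross3_le: "norm (cross3 x y) \<le> norm x * norm y"
proof -
  have "(norm (cross3 x y))\<^sup>2 \<le> (norm x * norm y)\<^sup>2"
    by (simp flip: norm_cross_dot)
  then show ?thesis
    by (rule power2_le_imp_le) simp
qed

text \<open>Crossing with the unit vector \<open>sph_r \<theta> \<phi>\<close> kills the radial part
  of \<open>w\<close> and turns the tangential part by a right angle, so the norm of the tangential
  part survives. In coordinates this is a polynomial identity modulo the two Pythagorean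
  relations.\<close>

lemma spherical_components_sq:
  "(w \<bullet> sph_theta \<theta> \<phi>)\<^sup>2 + (w \<bullet> sph_phi \<theta> \<phi>)\<^sup>2 = (norm (cross3 w (sph_r \<theta> \<phi>)))\<^sup>2"
proof -
  have t: "(sin \<theta>)\<^sup>2 = 1 - (cos \<theta>)\<^sup>2" and p: "(sin \<phi>)\<^sup>2 = 1 - (cos \<phi>)\<^sup>2"
    by (simp_all add: sin_squared_eq)
  show ?thesis
    unfolding power2_norm_eq_inner cross3_def sph_r_def sph_theta_def sph_phi_def inner_vec_def
      sum_3 vector_3 inner_real_def
    using t p by algebra
qed

lemma cdot_cvec: "cdot (c *s cvec a) (cvec b) = c * complex_of_real (a \<bullet> b)"
  by (simp add: cdot_def cvec_def inner_vec_def sum_distrib_left mult.assoc)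

text \<open>The parametrisation has the constant orthonormal partial derivatives \<open>l1\<close>
  and \<open>l2\<close>, so its area element is 1.\<close>

lemma surface_integral_plate:
  assumes "orthonormal3 n l1 l2"
  shows "surface_integral (plate_param l1 l2) (plate_domain L1 L2) f =
         integral (plate_domain L1 L2) (\<lambda>(u, v). f (u *\<^sub>R l1 + v *\<^sub>R l2))"
proof -
  have "vector_derivative (\<lambda>s. s *\<^sub>R l1 + v *\<^sub>R l2) (at u) = l1"
    "vector_derivative (\<lambda>t. u *\<^sub>R l1 + t *\<^sub>R l2) (at v) = l2" for u v
    by (auto intro!: vector_derivative_at derivative_eq_intros)
  then show ?thesis
    by (simp add: surface_integral_def plate_param_def norm_cross3_orthonormal[OF assms])
qed

lemma integral_exp_i_plate_domain:
  fixes p q :: real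
  assumes "L1 \<ge> 0" "L2 \<ge> 0"
  shows "integral (plate_domain L1 L2) (\<lambda>(u, v). exp (\<i> * complex_of_real (p * u + q * v)))
         = complex_of_real (L1 * sinc (p * L1 / 2) * (L2 * sinc (q * L2 / 2)))"
proof -
  have "plate_domain L1 L2 = cbox (- L1 / 2, - L2 / 2) (L1 / 2, L2 / 2)"
    by (simp add: plate_domain_def cbox_Pair_eq)
  moreover have "continuous_on S (\<lambda>(u, v). exp (\<i> * complex_of_real (p * u + q * v)))" for S
    by (auto simp: case_prod_unfold intro!: continuous_intros)
  \<comment> \<open>Fubini for a continuous function on a box; the exponential of the sum splits
    into one factor per variable.\<close>
  ultimately have "integral (plate_domain L1 L2) (\<lambda>(u, v). exp (\<i> * complex_of_real (p * u + q * v)))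
      = integral {- L1 / 2 .. L1 / 2} (\<lambda>u. integral {- L2 / 2 .. L2 / 2}
          (\<lambda>v. exp (\<i> * complex_of_real (p * u)) * exp (\<i> * complex_of_real (q * v))))"
    by (simp add: integral_integrable_2dim integral_prod_continuous distrib_left exp_add)
  then show ?thesis
    by (simp only: integral_mult_right integral_mult_left integral_exp_i[OF assms(1)]
        integral_exp_i[OF assms(2)] flip: of_real_mult)
qed

text \<open>The direction \<open>b\<close> stays arbitrary and enters only through
  \<open>cross3 n a_H \<bullet> b\<close>, so one computation serves both spherical
  components.\<close>

lemma far_field_component_eq:
  assumes "orthonormal3 n l1 l2" "L1 \<ge> 0" "L2 \<ge> 0"
  shows "far_field_component k \<eta> H0 L1 L2 n l1 l2 a_t a_H a_r b d =
     - (\<i> * complex_of_real (k * \<eta>) * exp (- \<i> * complex_of_real (k * d))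
          / complex_of_real (4 * pi * d)) *
     complex_of_real (2 * H0 * (cross3 n a_H \<bullet> b) * (L1 * L2) *
       (sinc (k * L1 / 2 * ((a_r - a_t) \<bullet> l1)) * sinc (k * L2 / 2 * ((a_r - a_t) \<bullet> l2))))"
proof -
  define c where "c = complex_of_real (2 * H0 * (cross3 n a_H \<bullet> b))"
  define p where "p = k * ((a_r - a_t) \<bullet> l1)"
  define q where "q = k * ((a_r - a_t) \<bullet> l2)"
  have "cdot (induced_current k H0 n a_t a_H (u *\<^sub>R l1 + v *\<^sub>R l2)) (cvec b)
          * exp (\<i> * complex_of_real (k * ((u *\<^sub>R l1 + v *\<^sub>R l2) \<bullet> a_r)))
        = c * exp (\<i> * complex_of_real (p * u + q * v))" for u v
  proof -
    \<comment> \<open>The incident phase and the phase towards the observer combine to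
      \<open>k\<close> times the inner product of \<open>a_r - a_t\<close> with the plate point;
      \<open>p\<close> and \<open>q\<close> are its rates along \<open>l1\<close> and
      \<open>l2\<close>.\<close>
    have "\<i> * complex_of_real (p * u + q * v) =
        - \<i> * complex_of_real (k * (a_t \<bullet> (u *\<^sub>R l1 + v *\<^sub>R l2)))
        + \<i> * complex_of_real (k * ((u *\<^sub>R l1 + v *\<^sub>R l2) \<bullet> a_r))"
      by (simp add: p_def q_def complex_eq_iff inner_simps inner_commute algebra_simps)
    then show ?thesis
      unfolding induced_current_eq cdot_cvec by (simp only: exp_add) (simp add: c_def)
  qed
  then have "surface_integral (plate_param l1 l2) (plate_domain L1 L2)
       (\<lambda>r'. cdot (induced_current k H0 n a_t a_H r') (cvec b)
             * exp (\<i> * complex_of_real (k * (r' \<bullet> a_r))))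
     = c * complex_of_real (L1 * sinc (p * L1 / 2) * (L2 * sinc (q * L2 / 2)))"
    unfolding surface_integral_plate[OF assms(1)]
    by (simp only: case_prod_unfold integral_mult_right
        integral_exp_i_plate_domain[OF assms(2,3), unfolded case_prod_unfold])
  then show ?thesis
    unfolding far_field_component_def by (simp add: c_def p_def q_def mult_ac)
qed

lemma reflected_sq_eq:
  assumes "orthonormal3 n l1 l2" "L1 \<ge> 0" "L2 \<ge> 0"
  shows "reflected_sq k \<eta> H0 L1 L2 n l1 l2 a_t a_H \<theta> \<phi> d =
     (k * \<eta> / (4 * pi * d))\<^sup>2 * (2 * H0 * L1 * L2)\<^sup>2 *
     f_Js n a_H (sph_r \<theta> \<phi>) * f_AF k L1 L2 l1 l2 a_t (sph_r \<theta> \<phi>)"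
proof -
  have "(cmod (far_field_component k \<eta> H0 L1 L2 n l1 l2 a_t a_H (sph_r \<theta> \<phi>) b d))\<^sup>2 =
     (k * \<eta> / (4 * pi * d))\<^sup>2 * (2 * H0 * L1 * L2)\<^sup>2 *
     f_AF k L1 L2 l1 l2 a_t (sph_r \<theta> \<phi>) * (cross3 n a_H \<bullet> b)\<^sup>2" for b
    unfolding far_field_component_eq[OF assms]
    by (simp add: f_AF_def norm_mult norm_divide power_mult_distrib power_divide mult_ac
        flip: of_real_mult)
  then show ?thesis
    unfolding reflected_sq_def f_Js_def spherical_components_sq[symmetric]
    by (simp add: algebra_simps)
qed

lemma f_Js_le_one:
  assumes "norm n = 1" "norm a_H = 1" "norm a_r = 1"
  shows "f_Js n a_H a_r \<le> 1"
proof -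
  have "norm (cross3 (cross3 n a_H) a_r) \<le> 1"
    using norm_cross3_le[of "cross3 n a_H" a_r] norm_cross3_le[of n a_H] assms by simp
  then show ?thesis
    by (simp add: f_Js_def power_le_one)
qed

lemma f_AF_le_one: "f_AF k L1 L2 l1 l2 a_t a_r \<le> 1"
  unfolding f_AF_def
  by (intro mult_le_one) (simp_all only: abs_square_le_1 abs_sinc_le_one zero_le_power2)

text \<open>Spherical angles of \<open>a_r\<close> are not unique, so the claim covers every choice;
  \<open>unit_vector_sph\<close> shows that one exists. Convergence is asserted separately because
  \<open>Lim\<close> is unspecified when no limit exists.\<close>

theorem theorem1:
  fixes L1 L2 lam \<eta> H0 k :: real
    and n l1 l2 a_t a_E a_H a_r :: "real^3"
  assumes "L1 > 0" "L2 > 0" "lam > 0" "\<eta> > 0" "H0 > 0"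
    and "k = 2 * pi / lam"
    and "orthonormal3 n l1 l2"
    and "orthonormal3 a_t a_E a_H"
    and "a_t = cross3 a_E a_H"
    and "norm a_r = 1"
  shows "(\<forall>\<theta> \<phi>. a_r = sph_r \<theta> \<phi> \<longrightarrow>
            (scattering_ratio k \<eta> H0 L1 L2 n l1 l2 a_t a_E a_H \<theta> \<phi> \<longlongrightarrow>
               radar_cross_section k \<eta> H0 L1 L2 n l1 l2 a_t a_E a_H \<theta> \<phi>) at_top \<and>
            radar_cross_section k \<eta> H0 L1 L2 n l1 l2 a_t a_E a_H \<theta> \<phi> =
              sigma_max L1 L2 lam * f_Js n a_H a_r * f_AF k L1 L2 l1 l2 a_t a_r) \<and>
         f_Js n a_H a_r \<le> 1 \<and>
         f_AF k L1 L2 l1 l2 a_t a_r \<le> 1"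
proof -
  have LIM: "(scattering_ratio k \<eta> H0 L1 L2 n l1 l2 a_t a_E a_H \<theta> \<phi> \<longlongrightarrow>
      sigma_max L1 L2 lam * f_Js n a_H (sph_r \<theta> \<phi>) * f_AF k L1 L2 l1 l2 a_t (sph_r \<theta> \<phi>)) at_top"
    for \<theta> \<phi>
  proof (rule tendsto_eventually, rule eventually_mono[OF eventually_gt_at_top[of 0]])
    fix d :: real
    assume "d > 0"
    have "norm a_E = 1"
      using assms by (simp add: orthonormal3_def)
    then have E: "(norm (incident_E k \<eta> H0 a_t a_E 0))\<^sup>2 = \<eta>\<^sup>2 * H0\<^sup>2"
      by (rule norm_incident_E)
    \<comment> \<open>The constants \<open>4 * pi * d\<^sup>2 * (k * \<eta> / (4 * pi * d))\<^sup>2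
      * (2 * H0 * L1 * L2)\<^sup>2 / (\<eta>\<^sup>2 * H0\<^sup>2)\<close> reduce to
      \<open>k\<^sup>2 * L1\<^sup>2 * L2\<^sup>2 / pi\<close>, which is \<open>sigma_max\<close>
      once \<open>k = 2 * pi / lam\<close>.\<close>
    show "scattering_ratio k \<eta> H0 L1 L2 n l1 l2 a_t a_E a_H \<theta> \<phi> d =
        sigma_max L1 L2 lam * f_Js n a_H (sph_r \<theta> \<phi>) * f_AF k L1 L2 l1 l2 a_t (sph_r \<theta> \<phi>)"
      using assms(1-5) \<open>d > 0\<close>
      unfolding scattering_ratio_def E reflected_sq_eq[OF assms(7) less_imp_le less_imp_le, OF assms(1,2)]
      by (simp add: sigma_max_def assms(6) field_simps power2_eq_square)
  qed
  have "norm n = 1" "norm a_H = 1"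
    using assms by (simp_all add: orthonormal3_def)
  then show ?thesis
    using LIM tendsto_Lim[OF trivial_limit_at_top_linorder LIM] f_Js_le_one f_AF_le_one assms(10)
    by (simp add: radar_cross_section_def)
qed

end
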